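(* There exists a finite simple graph whose vertices are $37$ distinct points of $\mathbb{Z}^4$, with $386$ edges, each edge joining two vertices at tropical distance $2$ from one another, such that the graph is $11$-colorable but not $10$-colorable (in the sense of proper vertex coloring).
   Context: The tropical distance between $\mathbf{x}=(x_1,\ldots,x_4)$ and $\mathbf{y}=(y_1,\ldots,y_4)$ in $\mathbb{Z}^4\subset\mathbb{R}^4$ is $$d_{\mathrm{tr}}(\mathbf{x},\mathbf{y}) = \max\Big\{\max_{1\le i\le 4}|x_i-y_i|,\ \max_{1\le i,j\le 4}(x_i-y_i-x_j+y_j)\Big\} = \max\Big\{\max_{1\le i\le 4}(x_i-y_i),0\Big\}-\min\Big\{\min_{1\le i\le 4}(x_i-y_i),0\Big\}.$$ *)

theory Defs
  imports "HOL-Analysis.Finite_Cartesian_Product" "HOL-Library.FuncSet"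
begin

definition tropical_dist :: "int ^ 4 \<Rightarrow> int ^ 4 \<Rightarrow> int" where
  "tropical_dist x y =
     max (Max {\<bar>x $ i - y $ i\<bar> | i. True})
         (Max {x $ i - y $ i - x $ j + y $ j | i j. True})"

definition simple_graph :: "'a set \<Rightarrow> 'a set set \<Rightarrow> bool" where
  "simple_graph V E \<longleftrightarrow> (\<forall>e\<in>E. e \<subseteq> V \<and> card e = 2)"

definition colorable :: "nat \<Rightarrow> 'a set \<Rightarrow> 'a set set \<Rightarrow> bool" where
  "colorable k V E \<longleftrightarrow>
     (\<exists>c. c \<in> V \<rightarrow> {..<k} \<and> (\<forall>u\<in>V. \<forall>v\<in>V. {u, v} \<in> E \<longrightarrow> c u \<noteq> c v))"

lemma tropical_dist_eq_max_minus_min: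
  "tropical_dist x y =
     max (Max {x $ i - y $ i | i. True}) 0 - min (Min {x $ i - y $ i | i. True}) 0"
proof -
  define d where "d = (\<lambda>i. x $ i - y $ i)"
  let ?D = "{d i | i. True}"
  let ?A = "{\<bar>d i\<bar> | i. True}"
  let ?B = "{d i - d j | i j. True}"
  have D: "?D = range d" and A: "?A = range (\<lambda>i. \<bar>d i\<bar>)"
    and B: "?B = range (\<lambda>(i, j). d i - d j)"
    by auto
  have fin: "finite ?D" "finite ?A" "finite ?B"
    unfolding D A B by (rule finite_imageI, simp)+
  have ne: "?D \<noteq> {}" "?A \<noteq> {}" "?B \<noteq> {}" by auto
  obtain p where p: "Max ?D = d p" using Max_in[OF fin(1) ne(1)] by auto
  obtain q where q: "Min ?D = d q" using Min_in[OF fin(1) ne(1)] by auto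
  have up: "d i \<le> d p" for i unfolding p[symmetric] by (rule Max_ge[OF fin(1)]) auto
  have lo: "d q \<le> d i" for i unfolding q[symmetric] by (rule Min_le[OF fin(1)]) auto
  have "Max ?A = max (d p) (- d q)"
  proof (rule Max_eqI[OF fin(2)])
    fix a assume "a \<in> ?A"
    then obtain i where "a = \<bar>d i\<bar>" by auto
    then show "a \<le> max (d p) (- d q)" using up[of i] lo[of i] by linarith
  next
    have "max (d p) (- d q) = \<bar>d p\<bar> \<or> max (d p) (- d q) = \<bar>d q\<bar>"
      using lo[of p] by linarith
    then show "max (d p) (- d q) \<in> ?A" by blast
  qed
  moreover have "Max ?B = d p - d q"
  proof (rule Max_eqI[OF fin(3)])
    fix b assume "b \<in> ?B"
    then obtain i j where "b = d i - d j" by auto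
    then show "b \<le> d p - d q" using up[of i] lo[of j] by linarith
  qed auto
  moreover have "tropical_dist x y = max (Max ?A) (Max ?B)"
    by (simp add: tropical_dist_def d_def algebra_simps)
  ultimately have "tropical_dist x y = max (d p) 0 - min (d q) 0"
    using lo[of p] by linarith
  then show ?thesis using p q by (simp add: d_def)
qed

end

theory Submission imports Defs "HOL-Analysis.Cartesian_Space" begin

text \<open>
  It helps to describe a point of \<open>\<int>^4\<close> by five homogeneous coordinates, modulo adding a constant to
  all of them. The tropical distance of two points is then the spread of their difference, the
  largest minus the smallest coordinate, so that all permutations of the five coordinates are
  isometries. Name the unit vectors \<open>a, b, e\<^sub>1, e\<^sub>2, e\<^sub>3\<close>. The graph \<open>G\<close> consists of 37 points
  and of all pairs among them that are at distance 2. That it has 386 edges and that eleven given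
  sets are independent is a finite computation.

  The reason why ten colours do not suffice lies in four 10-cliques through the origin \<open>0\<close>. One,
  the central clique, has the other members
    \<open>a - e\<^sub>m\<close>, \<open>b - e\<^sub>m\<close> and \<open>a + b - e\<^sub>m - e\<^sub>n\<close>;
  each of the others, the caps \<open>C\<^sub>1, C\<^sub>2, C\<^sub>3\<close>, belongs to an index \<open>l\<close> and has the other members
    \<open>a + e\<^sub>l - e\<^sub>m - e\<^sub>n\<close>, \<open>b + e\<^sub>l - e\<^sub>m - e\<^sub>n\<close>, \<open>a + b - e\<^sub>m - e\<^sub>n\<close>, \<open>e\<^sub>l - e\<^sub>m\<close>, \<open>a - e\<^sub>m\<close>, \<open>b - e\<^sub>m\<close>,
  where \<open>m, n\<close> run through the other two indices. In a colouring with ten colours, every 10-clique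
  contains every colour.

  The points \<open>a\<close> and \<open>b\<close> are adjacent, so one of them, say \<open>b\<close>, does not have the colour of \<open>0\<close>.
  The central clique contains the colour of \<open>b\<close>, and the only points of it that are not adjacent
  to \<open>b\<close> are \<open>0\<close> and the three points \<open>b - e\<^sub>l\<close>. Hence \<open>b\<close> and some \<open>b - e\<^sub>l\<close> have the same
  colour. This colour also occurs in \<open>C\<^sub>l\<close>. But each member of \<open>C\<^sub>l\<close> other than \<open>0\<close> is adjacent to
  \<open>b\<close> or to \<open>b - e\<^sub>l\<close>, which is a contradiction.

  This argument uses only 24 of the points. The other 13, namely \<open>-a\<close>, \<open>-b\<close>, \<open>-e\<^sub>l\<close>, \<open>a + 2b\<close>,
  \<open>2a + b\<close>, \<open>a + 2b + e\<^sub>l\<close> and \<open>2a + b + e\<^sub>l\<close>, bring the numbers of vertices and edges to 37 and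
  386 without making an eleventh colour insufficient.
\<close>

section \<open>Cliques, independent sets and colourings\<close>

text \<open>A colouring is injective on a clique, so on a clique as large as the set of colours it is onto.\<close>

lemma clique_meets_every_color:
  assumes "distinct (map f K)" "length K = k" "f ` set K \<subseteq> {..<k}" "c < k"
  shows "\<exists>w\<in>set K. f w = c"
proof -
  have "card (f ` set K) = k"
    using distinct_card[OF assms(1)] assms(2) by simp
  then have "f ` set K = {..<k}"
    using assms(3) by (simp add: card_subset_eq)
  then show ?thesis using assms(4) by (metis imageE lessThan_iff)
qed

lemma distinct_map_if_sorted_wrt: "sorted_wrt (\<lambda>x y. f x \<noteq> f y) xs \<Longrightarrow> distinct (map f xs)"
  by (induction xs) auto

lemma colorable_if_independent_cover:
  assumes cover: "V = \<Union> (set Cs)"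
    and indep: "\<And>C u v. C \<in> set Cs \<Longrightarrow> u \<in> C \<Longrightarrow> v \<in> C \<Longrightarrow> {u, v} \<notin> E"
  shows "colorable (length Cs) V E"
proof -
  have "\<forall>v\<in>V. \<exists>n<length Cs. v \<in> Cs ! n"
    using cover by (metis UnionE in_set_conv_nth)
  then obtain c where c: "\<And>v. v \<in> V \<Longrightarrow> c v < length Cs \<and> v \<in> Cs ! c v"
    by metis
  have "c u \<noteq> c v" if "u \<in> V" "v \<in> V" "{u, v} \<in> E" for u v
    using c[OF that(1)] c[OF that(2)] indep[of "Cs ! c u" u v] that(3) nth_mem by metis
  then show ?thesis unfolding colorable_def using c by blast
qed

fun pairs :: "'a list \<Rightarrow> ('a \<times> 'a) list" where
  "pairs [] = []"
| "pairs (x # xs) = map (Pair x) xs @ pairs xs"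

lemma set_pairs_subset: "set (pairs xs) \<subseteq> set xs \<times> set xs"
  by (induction xs) auto

lemma pairs_cover:
  "x \<in> set xs \<Longrightarrow> y \<in> set xs \<Longrightarrow> x \<noteq> y \<Longrightarrow> (x, y) \<in> set (pairs xs) \<or> (y, x) \<in> set (pairs xs)"
  by (induction xs) auto

lemma distinct_unordered_pairs:
  "distinct xs \<Longrightarrow> distinct (map (\<lambda>(x, y). {x, y}) (pairs xs))"
proof (induction xs)
  case (Cons x xs)
  have "inj_on (\<lambda>y. {x, y}) (set xs)"
    by (auto simp: inj_on_def doubleton_eq_iff)
  with Cons set_pairs_subset[of xs] show ?case
    by (fastforce simp: distinct_map o_def doubleton_eq_iff)
qed simp

section \<open>Homogeneous coordinates\<close>

type_synonym hom = "int \<times> int \<times> int \<times> int \<times> int"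

fun point :: "hom \<Rightarrow> int ^ 4" where
  "point (a, b, x, y, z) =
     (\<chi> i. if i = 1 then a - z else if i = 2 then b - z else if i = 3 then x - z else y - z)"

fun spread :: "hom \<Rightarrow> hom \<Rightarrow> int" where
  "spread (a, b, x, y, z) (a', b', x', y', z') =
     max (max (max (max (a - a') (b - b')) (x - x')) (y - y')) (z - z') -
     min (min (min (min (a - a') (b - b')) (x - x')) (y - y')) (z - z')"

lemma tropical_dist_point: "tropical_dist (point p) (point q) = spread p q"
proof -
  obtain a b x y z where p: "p = (a, b, x, y, z)" by (metis surj_pair)
  obtain a' b' x' y' z' where q: "q = (a', b', x', y', z')" by (metis surj_pair)
  have range4: "{h i | i. True} = {h 1, h 2, h 3, h 4}" for h :: "4 \<Rightarrow> int"
    by (auto, metis exhaust_4)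
  have max_shift: "max (Max {A - Z, B - Z, X - Z, Y - Z}) 0 = max (max (max (max A B) X) Y) Z - Z"
    for A B X Y Z :: int by simp linarith
  have min_shift: "min (Min {A - Z, B - Z, X - Z, Y - Z}) 0 = min (min (min (min A B) X) Y) Z - Z"
    for A B X Y Z :: int by simp linarith
  have swap: "s - z - (t - z') = (s - t) - (z - z')" for s t :: int
    by simp
  show ?thesis
    unfolding tropical_dist_eq_max_minus_min range4 p q
    by (simp add: swap max_shift min_shift del: Max_insert Min_insert)
qed

lemma point_eq_imp_spread_0: "point p = point q \<Longrightarrow> spread p q = 0"
proof -
  have "spread q q = 0" by (cases q) simp
  moreover assume "point p = point q"
  ultimately show ?thesis by (metis tropical_dist_point)
qed

section \<open>The graph\<close>

text \<open>
  The vertices are listed by colour classes of a colouring with eleven colours. It was found by a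
  computer search and has no particular structure.
\<close>

definition color_classes :: "hom list list" where
  "color_classes =
    [[(0,0,0,0,0), (1,0,0,0,0), (0,0,0,0,-1)],
     [(0,1,0,0,0), (0,1,-1,0,0), (0,0,-1,0,0)],
     [(1,1,0,-1,-1), (0,0,0,1,-1)],
     [(1,1,-1,0,-1), (0,0,1,0,-1), (0,0,-1,0,1), (2,1,0,1,0)],
     [(1,1,-1,-1,0), (0,0,1,-1,0), (0,0,-1,1,0), (1,2,0,0,1)],
     [(1,0,0,0,-1), (0,0,0,-1,1), (2,1,1,0,0)],
     [(1,0,0,-1,0), (0,1,-1,1,-1), (0,0,0,-1,0)],
     [(1,0,-1,0,0), (0,1,1,-1,-1), (2,1,0,0,0), (2,1,0,0,1)],
     [(0,1,0,0,-1), (0,1,-1,-1,1), (0,-1,0,0,0), (1,2,0,1,0)],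
     [(0,1,0,-1,0), (1,2,0,0,0), (1,2,1,0,0)],
     [(1,0,1,-1,-1), (1,0,-1,1,-1), (1,0,-1,-1,1), (-1,0,0,0,0)]]"

definition verts :: "hom list" where
  "verts = concat color_classes"

definition edges :: "(hom \<times> hom) list" where
  "edges = filter (\<lambda>(p, q). spread p q = 2) (pairs verts)"

definition V37 :: "(int ^ 4) set" where
  "V37 = point ` set verts"

definition E386 :: "(int ^ 4) set set" where
  "E386 = {{u, v} | u v. u \<in> V37 \<and> v \<in> V37 \<and> tropical_dist u v = 2}"

lemma tropical_dist_commute: "tropical_dist u v = tropical_dist v u"
proof -
  have "{\<bar>u $ i - v $ i\<bar> | i. True} = {\<bar>v $ i - u $ i\<bar> | i. True}"
    by (simp add: abs_minus_commute)
  moreover have "{u $ i - v $ i - u $ j + v $ j | i j. True} =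
      {v $ i - u $ i - v $ j + u $ j | i j. True}" (is "?A = ?B")
  proof (intro set_eqI iffI)
    fix t assume "t \<in> ?A"
    then obtain i j where "t = v $ j - u $ j - v $ i + u $ i" by (auto simp: algebra_simps)
    then show "t \<in> ?B" by blast
  next
    fix t assume "t \<in> ?B"
    then obtain i j where "t = u $ j - v $ j - u $ i + v $ i" by (auto simp: algebra_simps)
    then show "t \<in> ?A" by blast
  qed
  ultimately show ?thesis by (simp add: tropical_dist_def)
qed

lemma edge_iff:
  "{u, v} \<in> E386 \<longleftrightarrow> u \<in> V37 \<and> v \<in> V37 \<and> tropical_dist u v = 2"
  unfolding E386_def by (auto simp: doubleton_eq_iff tropical_dist_commute)

lemma simple_graph_V37: "simple_graph V37 E386"
proof -
  have "card {u, v} = 2 \<and> {u, v} \<subseteq> V37"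
    if "u \<in> V37" "v \<in> V37" "tropical_dist u v = 2" for u v
  proof -
    obtain p where "u = point p" using \<open>u \<in> V37\<close> unfolding V37_def by auto
    then have "u \<noteq> v"
      using that(3) tropical_dist_point[of p p] point_eq_imp_spread_0[of p p] by auto
    then show ?thesis using that by simp
  qed
  then show ?thesis unfolding simple_graph_def E386_def by blast
qed

text \<open>
  Different quintuples can be homogeneous coordinates of one point, so it has to be checked that
  the 37 listed ones are pairwise at positive distance.
\<close>

lemma distinct_points: "distinct (map point verts)"
proof -
  have "sorted_wrt (\<lambda>p q. spread p q \<noteq> 0) verts" by code_simp
  then have "sorted_wrt (\<lambda>p q. point p \<noteq> point q) verts"
    by (rule sorted_wrt_mono_rel[rotated]) (use point_eq_imp_spread_0 in blast)
  then show ?thesis by (rule distinct_map_if_sorted_wrt)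
qed

lemma card_V37: "card V37 = 37"
proof -
  have "length verts = 37" by code_simp
  then show ?thesis
    using distinct_card[OF distinct_points] by (simp add: V37_def)
qed

text \<open>
  Since the points are distinct, the pairs of list entries in list order enumerate the unordered
  pairs of vertices without repetition, so counting edges is computing the length of a list.
\<close>

lemma card_E386: "card E386 = 386"
proof -
  let ?edge = "\<lambda>(p, q). {point p, point q}"
  have map_pairs: "pairs (map f xs) = map (map_prod f f) (pairs xs)" for f :: "hom \<Rightarrow> int ^ 4" and xs
    by (induction xs) auto
  have inj: "distinct (map ?edge (pairs verts))"
    using distinct_unordered_pairs[OF distinct_points]
    by (simp add: map_pairs o_def case_prod_unfold)
  have "distinct (map ?edge edges)"
    unfolding edges_def using inj by (rule distinct_map_filter)
  then have "card (?edge ` set edges) = length edges"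
    using distinct_card by force
  also have "length edges = 386" by code_simp
  also have "?edge ` set edges = E386"
  proof (intro set_eqI iffI)
    fix e assume "e \<in> ?edge ` set edges"
    then obtain pq where pq: "pq \<in> set edges" "e = ?edge pq" by blast
    obtain p q where "pq = (p, q)" by (rule prod.exhaust)
    with pq have e: "e = {point p, point q}"
      and "(p, q) \<in> set (pairs verts)" "spread p q = 2"
      by (simp_all add: edges_def)
    moreover from this have "p \<in> set verts" "q \<in> set verts"
      using set_pairs_subset[of verts] by blast+
    ultimately show "e \<in> E386"
      by (simp add: edge_iff V37_def tropical_dist_point)
  next
    fix e assume "e \<in> E386"
    then obtain u v where uv: "e = {u, v}" "u \<in> V37" "v \<in> V37" "tropical_dist u v = 2"
      unfolding E386_def by blast
    then obtain p q where pq: "p \<in> set verts" "q \<in> set verts"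
      and u: "u = point p" and v: "v = point q"
      unfolding V37_def by blast
    have e: "e = {point p, point q}" and s: "spread p q = 2"
      using uv(1,4) by (simp_all add: u v tropical_dist_point)
    have s': "spread q p = 2"
      using s tropical_dist_commute by (simp flip: tropical_dist_point)
    have "p \<noteq> q" using s point_eq_imp_spread_0[of p q] by auto
    from pairs_cover[OF pq this] have "(p, q) \<in> set edges \<or> (q, p) \<in> set edges"
      using s s' by (simp add: edges_def)
    moreover have "e = ?edge (p, q)" "e = ?edge (q, p)"
      using e by (simp_all add: insert_commute)
    ultimately show "e \<in> ?edge ` set edges" by blast
  qed
  finally show ?thesis .
qed

section \<open>Eleven colours suffice\<close>

lemma colorable_11: "colorable 11 V37 E386"
proof -
  have indep: "\<forall>C\<in>set color_classes. \<forall>p\<in>set C. \<forall>q\<in>set C. spread p q \<noteq> 2"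
    by code_simp
  have "colorable (length (map (\<lambda>C. point ` set C) color_classes)) V37 E386"
  proof (rule colorable_if_independent_cover)
    show "V37 = \<Union> (set (map (\<lambda>C. point ` set C) color_classes))"
      by (auto simp: V37_def verts_def)
    next
    fix C u v
    assume C: "C \<in> set (map (\<lambda>C. point ` set C) color_classes)" and "u \<in> C" "v \<in> C"
    from C obtain D where D: "D \<in> set color_classes" "C = point ` set D"
      unfolding set_map by blast
    with \<open>u \<in> C\<close> \<open>v \<in> C\<close> obtain p q where "p \<in> set D" "q \<in> set D"
      and uv: "u = point p" "v = point q"
      by blast
    with indep D(1) have "spread p q \<noteq> 2" by blast
    then show "{u, v} \<notin> E386" by (simp add: uv edge_iff tropical_dist_point)
  qed
  moreover have "length color_classes = 11" by code_simp
  ultimately show ?thesis by simp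
qed

section \<open>Ten colours do not suffice\<close>

definition central_clique :: "hom list" where
  "central_clique =
    [(0,0,0,0,0), (1,0,-1,0,0), (1,0,0,-1,0), (1,0,0,0,-1), (0,1,-1,0,0), (0,1,0,-1,0),
     (0,1,0,0,-1), (1,1,0,-1,-1), (1,1,-1,0,-1), (1,1,-1,-1,0)]"

definition cap1 :: "hom list" where
  "cap1 =
    [(0,0,0,0,0), (1,0,1,-1,-1), (0,1,1,-1,-1), (1,1,0,-1,-1), (0,0,1,-1,0), (0,0,1,0,-1),
     (1,0,0,-1,0), (1,0,0,0,-1), (0,1,0,-1,0), (0,1,0,0,-1)]"

definition cap2 :: "hom list" where
  "cap2 = map (\<lambda>(a, b, x, y, z). (a, b, y, x, z)) cap1"

definition cap3 :: "hom list" where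
  "cap3 = map (\<lambda>(a, b, x, y, z). (a, b, z, y, x)) cap1"

definition clique10 :: "hom list \<Rightarrow> bool" where
  "clique10 K \<longleftrightarrow> length K = 10 \<and> (\<forall>p\<in>set K. p \<in> set verts) \<and> sorted_wrt (\<lambda>p q. spread p q = 2) K"

lemma cliques: "\<forall>K\<in>set [central_clique, cap1, cap2, cap3]. clique10 K"
  by code_simp

text \<open>
  The point \<open>x\<close> is \<open>a\<close> or \<open>b\<close>, the only possible points \<open>y\<close> are \<open>x - e\<^sub>1, x - e\<^sub>2, x - e\<^sub>3\<close>, and
  \<open>K\<close> is the cap with the index of \<open>y\<close>.
\<close>

lemma cap_dominated:
  "\<forall>x\<in>set [(1,0,0,0,0), (0,1,0,0,0)]. \<forall>y\<in>set central_clique.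
     y = (0,0,0,0,0) \<or> spread y x = 2 \<or>
     (\<exists>K\<in>set [cap1, cap2, cap3]. \<forall>w\<in>set K.
        w = (0,0,0,0,0) \<or> spread w x = 2 \<or> spread w y = 2)"
  by code_simp

lemma not_colorable_10: "\<not> colorable 10 V37 E386"
proof
  assume "colorable 10 V37 E386"
  then obtain c :: "int ^ 4 \<Rightarrow> nat" where c: "c \<in> V37 \<rightarrow> {..<10}"
    and c_proper: "\<And>u v. u \<in> V37 \<Longrightarrow> v \<in> V37 \<Longrightarrow> {u, v} \<in> E386 \<Longrightarrow> c u \<noteq> c v"
    unfolding colorable_def by blast
  define f where "f p = c (point p)" for p
  have f_less: "f p < 10" if "p \<in> set verts" for p
    using c that unfolding f_def V37_def by blast
  have proper: "f p \<noteq> f q" if "p \<in> set verts" "q \<in> set verts" "spread p q = 2" for p q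
    unfolding f_def by (rule c_proper) (use that in \<open>simp_all add: edge_iff V37_def tropical_dist_point\<close>)
  have meets: "\<exists>w\<in>set K. w \<in> set verts \<and> f w = f x" if "clique10 K" "x \<in> set verts" for K x
  proof -
    have K: "length K = 10" "set K \<subseteq> set verts" "sorted_wrt (\<lambda>p q. spread p q = 2) K"
      using that(1) unfolding clique10_def by auto
    have "sorted_wrt (\<lambda>p q. f p \<noteq> f q) K"
      by (rule sorted_wrt_mono_rel[OF _ K(3)]) (use K(2) proper in blast)
    then have "distinct (map f K)" by (rule distinct_map_if_sorted_wrt)
    from clique_meets_every_color[OF this K(1) _ f_less[OF that(2)]] K(2) f_less
    show ?thesis by blast
  qed
  let ?o = "(0,0,0,0,0) :: hom" and ?a = "(1,0,0,0,0) :: hom" and ?b = "(0,1,0,0,0) :: hom"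
  have ab: "?a \<in> set verts" "?b \<in> set verts" "spread ?a ?b = 2" by code_simp+
  have "f ?a \<noteq> f ?b" by (rule proper[OF ab])
  then obtain x where "x = ?a \<or> x = ?b" and x_o: "f x \<noteq> f ?o" by metis
  then have x: "x \<in> set [?a, ?b]" and x_verts: "x \<in> set verts"
    using ab(1,2) by force+
  obtain y where y: "y \<in> set central_clique" "y \<in> set verts" "f y = f x"
    using meets[of central_clique, OF _ x_verts] cliques by auto
  have "y \<noteq> ?o" using y(3) x_o by metis
  moreover have "spread y x \<noteq> 2" using proper[OF y(2) x_verts] y(3) by blast
  ultimately obtain K where K: "K \<in> set [cap1, cap2, cap3]"
    and dom: "\<forall>w\<in>set K. w = ?o \<or> spread w x = 2 \<or> spread w y = 2"
    using cap_dominated x y(1) by blast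
  have "clique10 K" using cliques K by auto
  from meets[OF this x_verts] obtain w where w: "w \<in> set K" "w \<in> set verts" "f w = f x"
    by blast
  have "w \<noteq> ?o" using w(3) x_o by metis
  then show False
    using dom w proper[OF w(2) x_verts] proper[OF w(2) y(2)] y(3) by metis
qed

theorem mainTheorem4:
  "\<exists>(V :: (int ^ 4) set) E.
     finite V \<and> simple_graph V E \<and> card V = 37 \<and> card E = 386 \<and>
     (\<forall>u v. {u, v} \<in> E \<longrightarrow> tropical_dist u v = 2) \<and>
     colorable 11 V E \<and> \<not> colorable 10 V E"
proof (intro exI conjI)
  show "finite V37" by (simp add: V37_def)
  show "\<forall>u v. {u, v} \<in> E386 \<longrightarrow> tropical_dist u v = 2" by (simp add: edge_iff)
qed (fact simple_graph_V37 card_V37 card_E386 colorable_11 not_colorable_10)+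

end
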